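(* Let $n\ge 3$ and $m\ge 1$ be integers, and let $m=F_{n,c_1}+F_{n,c_2}+\cdots+F_{n,c_k}$ be the $n$-decomposition of $m$ (with $c_1<c_2<\cdots<c_k$). Then the concatenation $S_{c_k}\circ S_{c_{k-1}}\circ\cdots\circ S_{c_1}$ is equal to the string of the first $m$ letters of $S_\infty$.
   Context: For an integer $n\ge 2$, define $F_{n,1}=F_{n,2}=\cdots=F_{n,n}=1$ and $F_{n,m+1}=F_{n,m}+F_{n,m+1-n}$ for all $m\ge n$. The $n$-decomposition of a positive integer $m$ is its (known to exist and be unique) representation $m=\sum_{i=1}^k F_{n,c_i}$ with $k\ge 1$, $c_1\ge n$ and $c_i\ge c_{i-1}+n$ for $2\le i\le k$. Let $a_1,\dots,a_n$ be distinct letters and let $\circ$ denote concatenation of strings. Define $S_1=a_1,\dots,S_n=a_n$ (one-letter strings) and $S_m=S_{m-1}\circ S_{m-n}$ for $m\ge n+1$. For $m\ge n$, $S_m$ is a prefix of $S_{m+1}$, and $S_\infty$ (the $n$-string) is the infinite string having every $S_m$, $m\ge n$, as a prefix. *)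

theory Defs
  imports "HOL-Library.Stream"
begin

text \<open>Indices are 1-based; index \<open>0\<close> (and \<open>n = 0\<close>, where the recursion would not
  terminate) only receives a junk value.  The recursions are shifted to the form
  \<open>m \<mapsto> m - 1, m - n\<close> for \<open>m > n\<close>.\<close>

fun nfib :: "nat \<Rightarrow> nat \<Rightarrow> nat" where
  "nfib n m = (if n = 0 \<or> m \<le> n then 1 else nfib n (m - 1) + nfib n (m - n))"

declare nfib.simps [simp del]

lemma nfib_init: "1 \<le> m \<Longrightarrow> m \<le> n \<Longrightarrow> nfib n m = 1"
  by (simp add: nfib.simps)

lemma nfib_rec: "2 \<le> n \<Longrightarrow> n \<le> m \<Longrightarrow> nfib n (m + 1) = nfib n m + nfib n (m + 1 - n)"
  by (subst nfib.simps) auto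

text \<open>The list \<open>[c\<^sub>1, \<dots>, c\<^sub>k]\<close> is in increasing order.\<close>

definition is_n_decomposition :: "nat \<Rightarrow> nat \<Rightarrow> nat list \<Rightarrow> bool" where
  "is_n_decomposition n m cs \<longleftrightarrow>
     cs \<noteq> [] \<and> n \<le> hd cs \<and>
     (\<forall>i. Suc i < length cs \<longrightarrow> cs ! i + n \<le> cs ! Suc i) \<and>
     m = (\<Sum>c\<leftarrow>cs. nfib n c)"

fun nstr :: "(nat \<Rightarrow> 'a) \<Rightarrow> nat \<Rightarrow> nat \<Rightarrow> 'a list" where
  "nstr a n m = (if n = 0 \<or> m \<le> n then [a m] else nstr a n (m - 1) @ nstr a n (m - n))"

declare nstr.simps [simp del]

lemma nstr_init: "1 \<le> m \<Longrightarrow> m \<le> n \<Longrightarrow> nstr a n m = [a m]"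
  by (simp add: nstr.simps)

lemma nstr_rec: "2 \<le> n \<Longrightarrow> n + 1 \<le> m \<Longrightarrow> nstr a n m = nstr a n (m - 1) @ nstr a n (m - n)"
  by (subst nstr.simps) auto

definition is_n_string :: "(nat \<Rightarrow> 'a) \<Rightarrow> nat \<Rightarrow> 'a stream \<Rightarrow> bool" where
  "is_n_string a n s \<longleftrightarrow> (\<forall>m\<ge>n. \<exists>t. s = nstr a n m @- t)"

definition n_string :: "(nat \<Rightarrow> 'a) \<Rightarrow> nat \<Rightarrow> 'a stream" where
  "n_string a n = (THE s. is_n_string a n s)"

text \<open>The description in \<open>n_string\<close> is proper: there is exactly one such infinite string.\<close>

lemma length_nstr_ge: "2 \<le> n \<Longrightarrow> k + 1 \<le> length (nstr a n (n + k))"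
proof (induction k)
  case 0
  then show ?case using nstr_init[of n n a] by simp
next
  case (Suc k)
  have ne: "nstr a n j \<noteq> []" for j
  proof (induction j rule: less_induct)
    case (less j)
    then show ?case using Suc.prems by (subst nstr.simps) simp
  qed
  have "nstr a n (n + Suc k) = nstr a n (n + k) @ nstr a n (Suc k)"
    using Suc.prems nstr_rec[of n "n + Suc k" a] by simp
  moreover have "length (nstr a n (Suc k)) > 0" using ne by blast
  ultimately show ?case using Suc.IH[OF Suc.prems] by (simp del: length_greater_0_conv)
qed

lemma nstr_mono_prefix:
  assumes "2 \<le> n"
  shows "\<exists>w. nstr a n (n + k + j) = nstr a n (n + k) @ w"
proof (induction j)
  case 0
  then show ?case by simp
next
  case (Suc j)
  then obtain w where "nstr a n (n + k + j) = nstr a n (n + k) @ w" by blast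
  then have "nstr a n (n + k + Suc j) = nstr a n (n + k) @ w @ nstr a n (k + Suc j)"
    using assms nstr_rec[of n "n + k + Suc j" a] by (simp add: add.assoc)
  then show ?case by blast
qed

lemma nstr_nth_eq:
  assumes "2 \<le> n" "i < length (nstr a n (n + k))" "i < length (nstr a n (n + l))"
  shows "nstr a n (n + k) ! i = nstr a n (n + l) ! i"
proof -
  have *: "nstr a n (n + k) ! i = nstr a n (n + l) ! i"
    if kl: "k \<le> l" "i < length (nstr a n (n + k))" for k l
  proof -
    obtain w where "nstr a n (n + l) = nstr a n (n + k) @ w"
      using nstr_mono_prefix[OF assms(1), of a k "l - k"] kl(1) by auto
    then show ?thesis using kl(2) by (simp add: nth_append)
  qed
  show ?thesis
    using *[of k l] *[of l k, symmetric] assms(2,3) nat_le_linear[of k l] by blast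
qed

lemma ex1_n_string:
  assumes n: "2 \<le> n"
  shows "\<exists>!s. is_n_string a n s"
proof -
  have snth: "s !! i = nstr a n (n + i) ! i" if s: "is_n_string a n s" for s i
  proof -
    obtain t where "s = nstr a n (n + i) @- t"
      using s unfolding is_n_string_def by (meson le_add1)
    then show ?thesis using length_nstr_ge[OF n, of i a] by simp
  qed
  define s where "s = smap (\<lambda>i. nstr a n (n + i) ! i) nats"
  have "is_n_string a n s"
    unfolding is_n_string_def
  proof (intro allI impI)
    fix m assume "n \<le> m"
    then obtain k where m: "m = n + k" using le_Suc_ex by blast
    have "stake (length (nstr a n m)) s = nstr a n m"
    proof (rule nth_equalityI)
      fix i assume "i < length (stake (length (nstr a n m)) s)"
      then have i: "i < length (nstr a n m)" by simp
      then have "stake (length (nstr a n m)) s ! i = nstr a n (n + i) ! i"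
        by (simp add: s_def)
      also have "\<dots> = nstr a n m ! i"
        using nstr_nth_eq[OF n, of i a i k] length_nstr_ge[OF n, of i a] i m by simp
      finally show "stake (length (nstr a n m)) s ! i = nstr a n m ! i" .
    qed simp
    then have "s = nstr a n m @- sdrop (length (nstr a n m)) s"
      using stake_sdrop[of "length (nstr a n m)" s] by simp
    then show "\<exists>t. s = nstr a n m @- t" by blast
  qed
  moreover have "s1 = s2" if "is_n_string a n s1" "is_n_string a n s2" for s1 s2
  proof -
    have "snth s1 = snth s2"
      by (rule ext) (simp only: snth[OF that(1)] snth[OF that(2)])
    have "s1 = smap (snth s1) nats" by (rule stream_smap_nats)
    also have "\<dots> = smap (snth s2) nats" using \<open>snth s1 = snth s2\<close> by (rule arg_cong)
    also have "\<dots> = s2" by (rule stream_smap_nats[symmetric])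
    finally show ?thesis .
  qed
  ultimately show ?thesis by blast
qed

end

theory Submission
  imports Defs "HOL-Library.Sublist"
begin

text \<open>
  Since \<open>S\<^sub>c\<close> has length \<open>F\<^sub>c\<close>, the concatenation \<open>S\<^bsub>c\<^sub>k\<^esub> \<dots> S\<^bsub>c\<^sub>1\<^esub>\<close> has length \<open>m\<close>, so it is
  enough that it is a prefix of \<open>S\<^sub>\<infinity>\<close>.  It is in fact already a prefix of \<open>S\<^bsub>c\<^sub>k + 1\<^esub>\<close>
  (\<open>prefix_concat_nstr\<close>): that string is \<open>S\<^bsub>c\<^sub>k\<^esub>\<close> followed by \<open>S\<^bsub>c\<^sub>k + 1 - n\<^esub>\<close>, and by induction
  on \<open>k\<close> the remaining factors form a prefix of \<open>S\<^bsub>c\<^sub>k\<^sub>-\<^sub>1 + 1\<^esub>\<close>.  The gap condition says exactly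
  that \<open>c\<^sub>k\<^sub>-\<^sub>1 + 1 \<le> c\<^sub>k + 1 - n\<close>, and \<open>c\<^sub>k\<^sub>-\<^sub>1 \<ge> n\<close> puts both indices in the range where the
  strings \<open>S\<^sub>j\<close> extend one another.
\<close>

lemma length_nstr: "length (nstr a n m) = nfib n m"
proof (induction m rule: less_induct)
  case (less m)
  then show ?case by (subst nstr.simps, subst nfib.simps) auto
qed

lemma prefix_nstr:
  assumes "2 \<le> n" "n \<le> i" "i \<le> j"
  shows "prefix (nstr a n i) (nstr a n j)"
  using nstr_mono_prefix[OF assms(1), of a "i - n" "j - i"] assms by (auto simp: prefix_def)

lemma nstr_Suc: "2 \<le> n \<Longrightarrow> n \<le> c \<Longrightarrow> nstr a n (Suc c) = nstr a n c @ nstr a n (Suc c - n)"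
  using nstr_rec[of n "Suc c" a] by simp

text \<open>The index \<open>Suc (last cs)\<close> is what lets the induction close: \<open>S\<close> at this index splits off
  \<open>S\<close> at \<open>last cs\<close>, and the gap condition turns the same bound for the shorter list into a
  prefix of what is left.\<close>

lemma prefix_concat_nstr:
  assumes "2 \<le> n" "cs \<noteq> []" "n \<le> hd cs" "successively (\<lambda>c d. c + n \<le> d) cs"
  shows "n \<le> last cs \<and> prefix (concat (map (nstr a n) (rev cs))) (nstr a n (Suc (last cs)))"
  using assms(2-)
proof (induction cs rule: rev_induct)
  case Nil
  then show ?case by simp
next
  case (snoc c cs)
  show ?case
  proof (cases "cs = []")
    case True
    then show ?thesis using snoc.prems prefix_nstr[OF assms(1), of c "Suc c" a] by simp
  next
    case False
    then have gap: "last cs + n \<le> c" and "n \<le> last cs"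
      and IH: "prefix (concat (map (nstr a n) (rev cs))) (nstr a n (Suc (last cs)))"
      using snoc by (auto simp: successively_append_iff)
    then have "prefix (nstr a n (Suc (last cs))) (nstr a n (Suc c - n))"
      by (intro prefix_nstr[OF assms(1)]) auto
    with IH have "prefix (concat (map (nstr a n) (rev cs))) (nstr a n (Suc c - n))"
      by (rule prefix_order.trans)
    then show ?thesis using gap \<open>n \<le> last cs\<close> nstr_Suc[OF assms(1), of c a] by simp
  qed
qed

lemma stake_n_string:
  assumes "2 \<le> n" "n \<le> j" "prefix w (nstr a n j)"
  shows "stake (length w) (n_string a n) = w"
proof -
  have "is_n_string a n (n_string a n)"
    unfolding n_string_def by (rule theI'[OF ex1_n_string[OF assms(1)]])
  then obtain t where "n_string a n = nstr a n j @- t"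
    using assms(2) unfolding is_n_string_def by blast
  moreover obtain u where "nstr a n j = w @ u" using assms(3) by (auto simp: prefix_def)
  ultimately show ?thesis by (simp add: stake_shift)
qed

theorem theorem1p4:
  fixes n m :: nat and a :: "nat \<Rightarrow> 'a" and cs :: "nat list"
  assumes "n \<ge> 3" and "m \<ge> 1"
    and "inj_on a {1..n}"
    and "is_n_decomposition n m cs"
  shows "concat (map (nstr a n) (rev cs)) = stake m (n_string a n)"
proof -
  let ?w = "concat (map (nstr a n) (rev cs))"
  have n: "2 \<le> n" using assms(1) by simp
  have dec: "cs \<noteq> []" "n \<le> hd cs" "successively (\<lambda>c d. c + n \<le> d) cs"
    and m: "m = (\<Sum>c\<leftarrow>cs. nfib n c)"
    using assms(4) by (auto simp: is_n_decomposition_def successively_conv_nth)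
  have "length ?w = m"
    by (simp add: m length_concat length_nstr comp_def rev_map[symmetric] sum_list_rev)
  moreover have "stake (length ?w) (n_string a n) = ?w"
    using prefix_concat_nstr[OF n dec, of a] by (intro stake_n_string[OF n, of "Suc (last cs)"]) auto
  ultimately show ?thesis by simp
qed

end
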